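(* Let $T$ be a consistent RE theory, $n\ge1$, and $I:{\sf Num}\unlhd T$ an interpretation such that the pairing function $J_2$ is strongly definable in $T$ w.r.t. $I$. If $T$ is exact $n$-Rosser w.r.t. $I$, then $T$ is exact $(n+1)$-Rosser w.r.t. $I$.
   Context: $J_2:\mathbb N^2\to\mathbb N$ is a fixed recursive pairing function (bijection). ${\sf Num}$ is the theory in the language $\{\mathbf 0,\mathbf S\}$ with axioms $\overline m\neq\overline n$ for $m\neq n$, where $\overline 0=\mathbf 0$, $\overline{k+1}=\mathbf S\overline k$. An interpretation $I:{\sf Num}\unlhd T$ is a translation of the language of ${\sf Num}$ into that of $T$ such that $T$ proves totality of translated function symbols on the domain, the translations of all theorems of ${\sf Num}$ and of the equality axioms; $\overline a^I$ is the $I$-translation of $\overline a$. $J_2$ is strongly definable in $T$ w.r.t. $I$ if there is a formula $\theta(x,y,z)$ with $T\vdash\forall z[\theta(\overline a^I,\overline b^I,z)\leftrightarrow z=\overline{J_2(a,b)}^I]$ for all $a,b$. For disjoint $k$-ary relations $M_1,M_2$, a formula $\phi(x_1,\dots,x_k)$ with exactly $k$ free variables exactly separates $M_1$ from $M_2$ w.r.t. $I$ if $\vec a\in M_1\Leftrightarrow T\vdash\phi(\overline{a_1}^I,\dots,\overline{a_k}^I)$ and $\vec a\in M_2\Leftrightarrow T\vdash\neg\phi(\overline{a_1}^I,\dots,\overline{a_k}^I)$. $T$ is exact $k$-Rosser w.r.t. $I$ if every disjoint pair of $k$-ary RE relations is exactly separated by some formula w.r.t. $I$. *)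

theory Defs
  imports Main "HOL-Library.Nat_Bijection"
begin

section \<open>Recursive functions and RE relations\<close>

text \<open>Kleene's partial recursive functions.  Codes carry no arity: on argument lists of any fixed
  length \<open>k\<close> a code denotes a \<open>k\<close>-ary partial recursive function.  A \<open>k\<close>-ary relation is RE if it is
  the domain of such a function.\<close>

datatype recf = Zero | Succ | Proj nat | Comp recf "recf list" | PrimRec recf recf | Minim recf

inductive computes :: "recf \<Rightarrow> nat list \<Rightarrow> nat \<Rightarrow> bool" where
  Zero: "computes Zero xs 0"
| Succ: "computes Succ [x] (Suc x)"
| Proj: "i < length xs \<Longrightarrow> computes (Proj i) xs (xs ! i)"
| Comp: "list_all2 (\<lambda>g y. computes g xs y) gs ys \<Longrightarrow> computes f ys z
         \<Longrightarrow> computes (Comp f gs) xs z"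
| PrimRec_0: "computes f xs y \<Longrightarrow> computes (PrimRec f g) (0 # xs) y"
| PrimRec_Suc: "computes (PrimRec f g) (x # xs) y \<Longrightarrow> computes g (x # y # xs) z
         \<Longrightarrow> computes (PrimRec f g) (Suc x # xs) z"
| Minim: "computes f (x # xs) 0 \<Longrightarrow> (\<forall>w<x. \<exists>y>0. computes f (w # xs) y)
         \<Longrightarrow> computes (Minim f) xs x"

definition recursive_fun2 :: "(nat \<times> nat \<Rightarrow> nat) \<Rightarrow> bool" where
  "recursive_fun2 F \<longleftrightarrow> (\<exists>f. \<forall>a b. computes f [a, b] (F (a, b)))"

definition re_rel :: "nat \<Rightarrow> nat list set \<Rightarrow> bool" where
  "re_rel k R \<longleftrightarrow> (\<forall>xs\<in>R. length xs = k) \<and>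
     (\<exists>f. \<forall>xs. length xs = k \<longrightarrow> (xs \<in> R \<longleftrightarrow> (\<exists>y. computes f xs y)))"

definition recursive_pairing :: "(nat \<times> nat \<Rightarrow> nat) \<Rightarrow> bool" where
  "recursive_pairing J \<longleftrightarrow> recursive_fun2 J \<and> bij J"


section \<open>First-order logic with equality\<close>

text \<open>Variables are de Bruijn indices.  A symbol is a name together with an arity, so the same name
  used with two arities is two different symbols.\<close>

datatype tm = Var nat | Fn nat "tm list"

datatype fm = Falsum | Equal tm tm | Pred nat "tm list" | Implies fm fm | Forall fm

abbreviation Neg :: "fm \<Rightarrow> fm" where "Neg p \<equiv> Implies p Falsum"
abbreviation Verum :: fm where "Verum \<equiv> Neg Falsum"
abbreviation And :: "fm \<Rightarrow> fm \<Rightarrow> fm" where "And p q \<equiv> Neg (Implies p (Neg q))"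
abbreviation Iff :: "fm \<Rightarrow> fm \<Rightarrow> fm" where "Iff p q \<equiv> And (Implies p q) (Implies q p)"
abbreviation Exists :: "fm \<Rightarrow> fm" where "Exists p \<equiv> Neg (Forall (Neg p))"
abbreviation Foralls :: "nat \<Rightarrow> fm \<Rightarrow> fm" where "Foralls k p \<equiv> (Forall ^^ k) p"
abbreviation Existss :: "nat \<Rightarrow> fm \<Rightarrow> fm" where "Existss k p \<equiv> ((\<lambda>q. Exists q) ^^ k) p"
abbreviation Conj :: "fm list \<Rightarrow> fm" where "Conj ps \<equiv> foldr (\<lambda>p q. And p q) ps Verum"

record lang =
  funs :: "(nat \<times> nat) set"
  rels :: "(nat \<times> nat) set"

primrec wf_tm :: "lang \<Rightarrow> tm \<Rightarrow> bool" where
  "wf_tm L (Var n) \<longleftrightarrow> True"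
| "wf_tm L (Fn f ts) \<longleftrightarrow> (f, length ts) \<in> funs L \<and> list_all (wf_tm L) ts"

primrec wf_fm :: "lang \<Rightarrow> fm \<Rightarrow> bool" where
  "wf_fm L Falsum \<longleftrightarrow> True"
| "wf_fm L (Equal s t) \<longleftrightarrow> wf_tm L s \<and> wf_tm L t"
| "wf_fm L (Pred r ts) \<longleftrightarrow> (r, length ts) \<in> rels L \<and> list_all (wf_tm L) ts"
| "wf_fm L (Implies p q) \<longleftrightarrow> wf_fm L p \<and> wf_fm L q"
| "wf_fm L (Forall p) \<longleftrightarrow> wf_fm L p"

primrec fv_tm :: "tm \<Rightarrow> nat set" where
  "fv_tm (Var n) = {n}"
| "fv_tm (Fn f ts) = \<Union> (set (map fv_tm ts))"

primrec fv :: "fm \<Rightarrow> nat set" where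
  "fv Falsum = {}"
| "fv (Equal s t) = fv_tm s \<union> fv_tm t"
| "fv (Pred r ts) = \<Union> (set (map fv_tm ts))"
| "fv (Implies p q) = fv p \<union> fv q"
| "fv (Forall p) = {n. Suc n \<in> fv p}"

definition sentence :: "lang \<Rightarrow> fm \<Rightarrow> bool" where
  "sentence L p \<longleftrightarrow> wf_fm L p \<and> fv p = {}"

primrec subst_tm :: "(nat \<Rightarrow> tm) \<Rightarrow> tm \<Rightarrow> tm" where
  "subst_tm \<sigma> (Var n) = \<sigma> n"
| "subst_tm \<sigma> (Fn f ts) = Fn f (map (subst_tm \<sigma>) ts)"

definition under_binder :: "(nat \<Rightarrow> tm) \<Rightarrow> nat \<Rightarrow> tm" where
  "under_binder \<sigma> n = (case n of 0 \<Rightarrow> Var 0 | Suc m \<Rightarrow> subst_tm (\<lambda>i. Var (Suc i)) (\<sigma> m))"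

primrec subst :: "(nat \<Rightarrow> tm) \<Rightarrow> fm \<Rightarrow> fm" where
  "subst \<sigma> Falsum = Falsum"
| "subst \<sigma> (Equal s t) = Equal (subst_tm \<sigma> s) (subst_tm \<sigma> t)"
| "subst \<sigma> (Pred r ts) = Pred r (map (subst_tm \<sigma>) ts)"
| "subst \<sigma> (Implies p q) = Implies (subst \<sigma> p) (subst \<sigma> q)"
| "subst \<sigma> (Forall p) = Forall (subst (under_binder \<sigma>) p)"

definition lift :: "fm \<Rightarrow> fm" where
  "lift p = subst (\<lambda>n. Var (Suc n)) p"

definition inst :: "tm \<Rightarrow> fm \<Rightarrow> fm" where
  "inst t p = subst (\<lambda>n. case n of 0 \<Rightarrow> t | Suc m \<Rightarrow> Var m) p"

text \<open>For a formula \<open>p\<close> with free variables among \<open>0, \<dots>, k - 1\<close> and \<open>vs\<close> of length \<open>k\<close>,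
  \<open>at_vars p vs\<close> is \<open>p\<close> with the variables listed in \<open>vs\<close> put for its free variables.\<close>

definition at_vars :: "fm \<Rightarrow> nat list \<Rightarrow> fm" where
  "at_vars p vs = subst (\<lambda>i. Var (vs ! i)) p"

record fo_theory =
  lang_of :: lang
  axioms :: "fm set"

definition wf_theory :: "fo_theory \<Rightarrow> bool" where
  "wf_theory T \<longleftrightarrow> (\<forall>p\<in>axioms T. sentence (lang_of T) p)"

text \<open>Classical natural deduction; the well-formedness premises keep derivations inside the
  language of the theory.\<close>

inductive derives :: "fo_theory \<Rightarrow> fm list \<Rightarrow> fm \<Rightarrow> bool" for T where
  Axiom: "p \<in> axioms T \<Longrightarrow> derives T \<Gamma> p"
| Assm: "p \<in> set \<Gamma> \<Longrightarrow> wf_fm (lang_of T) p \<Longrightarrow> derives T \<Gamma> p"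
| ImpI: "derives T (p # \<Gamma>) q \<Longrightarrow> wf_fm (lang_of T) p \<Longrightarrow> derives T \<Gamma> (Implies p q)"
| ImpE: "derives T \<Gamma> (Implies p q) \<Longrightarrow> derives T \<Gamma> p \<Longrightarrow> derives T \<Gamma> q"
| RAA: "derives T (Neg p # \<Gamma>) Falsum \<Longrightarrow> wf_fm (lang_of T) p \<Longrightarrow> derives T \<Gamma> p"
| AllI: "derives T (map lift \<Gamma>) p \<Longrightarrow> derives T \<Gamma> (Forall p)"
| AllE: "derives T \<Gamma> (Forall p) \<Longrightarrow> wf_tm (lang_of T) t \<Longrightarrow> derives T \<Gamma> (inst t p)"
| Refl: "wf_tm (lang_of T) t \<Longrightarrow> derives T \<Gamma> (Equal t t)"
| Leibniz: "derives T \<Gamma> (Equal s t) \<Longrightarrow> derives T \<Gamma> (inst s p) \<Longrightarrow> derives T \<Gamma> (inst t p)"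

definition proves :: "fo_theory \<Rightarrow> fm \<Rightarrow> bool"  (infix \<open>\<turnstile>\<close> 50) where
  "T \<turnstile> p \<longleftrightarrow> derives T [] p"

definition consistent :: "fo_theory \<Rightarrow> bool" where
  "consistent T \<longleftrightarrow> \<not> T \<turnstile> Falsum"

primrec code_tm :: "tm \<Rightarrow> nat" where
  "code_tm (Var n) = prod_encode (0, n)"
| "code_tm (Fn f ts) = prod_encode (1, prod_encode (f, list_encode (map code_tm ts)))"

primrec code_fm :: "fm \<Rightarrow> nat" where
  "code_fm Falsum = prod_encode (0, 0)"
| "code_fm (Equal s t) = prod_encode (1, prod_encode (code_tm s, code_tm t))"
| "code_fm (Pred r ts) = prod_encode (2, prod_encode (r, list_encode (map code_tm ts)))"
| "code_fm (Implies p q) = prod_encode (3, prod_encode (code_fm p, code_fm q))"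
| "code_fm (Forall p) = prod_encode (4, code_fm p)"

text \<open>RE means that the set of theorems is RE; no effectiveness condition is put on the language.\<close>

definition re_theory :: "fo_theory \<Rightarrow> bool" where
  "re_theory T \<longleftrightarrow> re_rel 1 {[code_fm p] | p. sentence (lang_of T) p \<and> T \<turnstile> p}"


section \<open>Translations and interpretations\<close>

text \<open>The free variables of \<open>tr_dom\<close>, \<open>tr_eq\<close>, \<open>tr_fun f k\<close>, \<open>tr_rel r k\<close> are among the first
  \<open>1\<close>, \<open>2\<close>, \<open>k + 1\<close>, \<open>k\<close> indices; in \<open>tr_fun f k\<close> the index \<open>k\<close> stands for the value.\<close>

record translation =
  tr_dom :: fm
  tr_eq :: fm
  tr_fun :: "nat \<Rightarrow> nat \<Rightarrow> fm"
  tr_rel :: "nat \<Rightarrow> nat \<Rightarrow> fm"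

definition is_translation :: "translation \<Rightarrow> lang \<Rightarrow> lang \<Rightarrow> bool" where
  "is_translation I L L' \<longleftrightarrow>
     wf_fm L' (tr_dom I) \<and> fv (tr_dom I) \<subseteq> {0} \<and>
     wf_fm L' (tr_eq I) \<and> fv (tr_eq I) \<subseteq> {0, 1} \<and>
     (\<forall>(f, k)\<in>funs L. wf_fm L' (tr_fun I f k) \<and> fv (tr_fun I f k) \<subseteq> {..k}) \<and>
     (\<forall>(r, k)\<in>rels L. wf_fm L' (tr_rel I r k) \<and> fv (tr_rel I r k) \<subseteq> {..<k})"

text \<open>\<open>tr_tm I t \<rho> v\<close> says that \<open>v\<close> is the value of \<open>t\<close>, where \<open>\<rho>\<close> maps the variables of \<open>t\<close> to the
  indices that represent them in the target formula.  Function symbols are unnested: the value of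
  \<open>F(t1, \<dots>, tk)\<close> is \<open>v\<close> if there are values \<open>y1, \<dots>, yk\<close> in the domain with \<open>F_I(y1, \<dots>, yk, v)\<close>.
  The target equality in the variable clause only identifies the auxiliary \<open>yi\<close> with the variable, so
  that, up to logical equivalence, arguments which are variables are not unnested; the source
  equality is translated by \<open>tr_eq\<close> in \<open>tr_fm\<close>.\<close>

primrec tr_tm :: "translation \<Rightarrow> tm \<Rightarrow> (nat \<Rightarrow> nat) \<Rightarrow> nat \<Rightarrow> fm" where
  "tr_tm I (Var n) = (\<lambda>\<rho> v. Equal (Var v) (Var (\<rho> n)))"
| "tr_tm I (Fn f ts) = (\<lambda>\<rho> v. let k = length ts in
     Existss k (And
       (Conj (map2 (\<lambda>g i. And (at_vars (tr_dom I) [i]) (g (\<lambda>n. \<rho> n + k) i))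
                   (map (tr_tm I) ts) [0..<k]))
       (at_vars (tr_fun I f k) ([0..<k] @ [v + k]))))"

definition tr_Equal :: "translation \<Rightarrow> (nat \<Rightarrow> nat) \<Rightarrow> tm \<Rightarrow> tm \<Rightarrow> fm" where
  "tr_Equal I \<rho> s t = (case (s, t) of
     (Var m, Var n) \<Rightarrow> at_vars (tr_eq I) [\<rho> m, \<rho> n]
   | _ \<Rightarrow> Exists (And (at_vars (tr_dom I) [0])
            (And (tr_tm I s (\<lambda>n. Suc (\<rho> n)) 0) (tr_tm I t (\<lambda>n. Suc (\<rho> n)) 0))))"

primrec tr_fm :: "translation \<Rightarrow> fm \<Rightarrow> (nat \<Rightarrow> nat) \<Rightarrow> fm" where
  "tr_fm I Falsum = (\<lambda>\<rho>. Falsum)"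
| "tr_fm I (Equal s t) = (\<lambda>\<rho>. tr_Equal I \<rho> s t)"
| "tr_fm I (Pred r ts) = (\<lambda>\<rho>. let k = length ts in
     Existss k (And
       (Conj (map2 (\<lambda>t i. And (at_vars (tr_dom I) [i]) (tr_tm I t (\<lambda>n. \<rho> n + k) i)) ts [0..<k]))
       (at_vars (tr_rel I r k) [0..<k])))"
| "tr_fm I (Implies p q) = (\<lambda>\<rho>. Implies (tr_fm I p \<rho>) (tr_fm I q \<rho>))"
| "tr_fm I (Forall p) = (\<lambda>\<rho>. Forall (Implies (at_vars (tr_dom I) [0])
     (tr_fm I p (\<lambda>n. case n of 0 \<Rightarrow> 0 | Suc m \<Rightarrow> Suc (\<rho> m)))))"

definition tr_sentence :: "translation \<Rightarrow> fm \<Rightarrow> fm" where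
  "tr_sentence I p = tr_fm I p id"

definition tr_total :: "translation \<Rightarrow> nat \<Rightarrow> nat \<Rightarrow> fm" where
  "tr_total I f k = Foralls k (Implies (Conj (map (\<lambda>i. at_vars (tr_dom I) [i]) [0..<k]))
     (Exists (And (at_vars (tr_dom I) [0]) (at_vars (tr_fun I f k) ([1..<Suc k] @ [0])))))"

text \<open>The equality axioms are derivable in every theory by \<open>Refl\<close> and \<open>Leibniz\<close>; they are listed
  because the definition of an interpretation mentions their translations separately.
  In the congruence axioms the two argument tuples are the variables \<open>0, \<dots>, k - 1\<close> and
  \<open>k, \<dots>, 2 * k - 1\<close>.\<close>

definition equality_axioms :: "lang \<Rightarrow> fm set" where
  "equality_axioms L =
     {Forall (Equal (Var 0) (Var 0)),
      Foralls 2 (Implies (Equal (Var 0) (Var 1)) (Equal (Var 1) (Var 0))),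
      Foralls 3 (Implies (And (Equal (Var 0) (Var 1)) (Equal (Var 1) (Var 2)))
                         (Equal (Var 0) (Var 2)))} \<union>
     {Foralls (2 * k) (Implies (Conj (map (\<lambda>i. Equal (Var i) (Var (k + i))) [0..<k]))
        (Equal (Fn f (map Var [0..<k])) (Fn f (map Var [k..<2 * k])))) | f k. (f, k) \<in> funs L} \<union>
     {Foralls (2 * k) (Implies (Conj (map (\<lambda>i. Equal (Var i) (Var (k + i))) [0..<k]))
        (Implies (Pred r (map Var [0..<k])) (Pred r (map Var [k..<2 * k])))) | r k. (r, k) \<in> rels L}"

definition interprets :: "translation \<Rightarrow> fo_theory \<Rightarrow> fo_theory \<Rightarrow> bool" where
  "interprets I S T \<longleftrightarrow>
     is_translation I (lang_of S) (lang_of T) \<and>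
     (\<forall>(f, k)\<in>funs (lang_of S). T \<turnstile> tr_total I f k) \<and>
     (\<forall>p. sentence (lang_of S) p \<and> S \<turnstile> p \<longrightarrow> T \<turnstile> tr_sentence I p) \<and>
     (\<forall>p\<in>equality_axioms (lang_of S). T \<turnstile> tr_sentence I p)"


section \<open>The theory Num, definability and exact Rosser theories\<close>

primrec numeral_tm :: "nat \<Rightarrow> tm" where
  "numeral_tm 0 = Fn 0 []"
| "numeral_tm (Suc n) = Fn 1 [numeral_tm n]"

definition Num :: fo_theory where
  "Num = \<lparr>lang_of = \<lparr>funs = {(0, 0), (1, 1)}, rels = {}\<rparr>,
          axioms = {Neg (Equal (numeral_tm m) (numeral_tm n)) | m n. m \<noteq> n}\<rparr>"

text \<open>A numeral is in general not translated to a term but to a formula: \<open>is_numeral I a\<close>, with the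
  single free variable \<open>0\<close>, says that this variable equals the \<open>I\<close>-translation of the numeral of \<open>a\<close>.
  Accordingly \<open>at_numerals I [a1, \<dots>, ak] p\<close>, the result of putting the translated numerals for the
  variables \<open>0, \<dots>, k - 1\<close> of \<open>p\<close>, is
  \<open>\<exists>xk. xk = ak \<and> \<dots> \<and> (\<exists>x1. x1 = a1 \<and> p)\<close>;
  the variables \<open>k, k + 1, \<dots>\<close> of \<open>p\<close> become \<open>0, 1, \<dots>\<close>.\<close>

definition is_numeral :: "translation \<Rightarrow> nat \<Rightarrow> fm" where
  "is_numeral I a = And (at_vars (tr_dom I) [0]) (tr_tm I (numeral_tm a) id 0)"

primrec at_numerals :: "translation \<Rightarrow> nat list \<Rightarrow> fm \<Rightarrow> fm" where
  "at_numerals I [] p = p"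
| "at_numerals I (a # as) p = at_numerals I as (Exists (And (is_numeral I a) p))"

definition strongly_definable2 :: "fo_theory \<Rightarrow> translation \<Rightarrow> (nat \<times> nat \<Rightarrow> nat) \<Rightarrow> bool" where
  "strongly_definable2 T I F \<longleftrightarrow>
     (\<exists>\<theta>. wf_fm (lang_of T) \<theta> \<and> fv \<theta> \<subseteq> {0, 1, 2} \<and>
       (\<forall>a b. T \<turnstile> Forall (Iff (at_numerals I [a, b] \<theta>) (is_numeral I (F (a, b))))))"

definition exactly_separates ::
    "fo_theory \<Rightarrow> translation \<Rightarrow> nat \<Rightarrow> fm \<Rightarrow> nat list set \<Rightarrow> nat list set \<Rightarrow> bool" where
  "exactly_separates T I k \<phi> M1 M2 \<longleftrightarrow>
     wf_fm (lang_of T) \<phi> \<and> fv \<phi> = {..<k} \<and>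
     (\<forall>as. length as = k \<longrightarrow>
        (as \<in> M1 \<longleftrightarrow> T \<turnstile> at_numerals I as \<phi>) \<and>
        (as \<in> M2 \<longleftrightarrow> T \<turnstile> Neg (at_numerals I as \<phi>)))"

definition exact_Rosser :: "fo_theory \<Rightarrow> translation \<Rightarrow> nat \<Rightarrow> bool" where
  "exact_Rosser T I k \<longleftrightarrow>
     (\<forall>M1 M2. re_rel k M1 \<and> re_rel k M2 \<and> M1 \<inter> M2 = {} \<longrightarrow>
        (\<exists>\<phi>. exactly_separates T I k \<phi> M1 M2))"

end

theory Submission
  imports Defs
begin

text \<open>
  Since \<open>J\<close> is a recursive bijection, replacing the first two entries \<open>a, b\<close> of a tuple by \<open>J(a, b)\<close>
  turns a disjoint pair of \<open>(n + 1)\<close>-ary RE relations into a disjoint pair of \<open>n\<close>-ary RE relations.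
  If \<open>\<phi>\<close> exactly separates the latter and \<open>\<theta>\<close> strongly defines \<open>J\<close>, then
  \<open>\<psi>(x0, x1, x2, \<dots>) = \<exists>z. \<theta>(x0, x1, z) \<and> \<phi>(z, x2, \<dots>)\<close> exactly separates the former: at the
  numerals of \<open>a, b\<close> it is provably equivalent to \<open>\<phi>\<close> at the numeral of \<open>J(a, b)\<close>.  The numerals are
  given by formulas, so with strong definability this equivalence only permutes existential quantifiers.
\<close>

section \<open>Recursive functions\<close>

inductive_cases computes_ZeroE: "computes Zero xs y"
inductive_cases computes_SuccE: "computes Succ xs y"
inductive_cases computes_ProjE: "computes (Proj i) xs y"
inductive_cases computes_CompE: "computes (Comp f gs) xs y"
inductive_cases computes_PrimRec_0E: "computes (PrimRec f g) (0 # xs) y"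
inductive_cases computes_PrimRec_SucE: "computes (PrimRec f g) (Suc x # xs) y"
inductive_cases computes_MinimE: "computes (Minim f) xs y"

text \<open>Induction on the first derivation, inverting the second. Determinism is needed later
  because convergence of a composition must force convergence of its outer code at the intended
  arguments.\<close>

lemma computes_deterministic: "computes f xs y \<Longrightarrow> computes f xs z \<Longrightarrow> z = y"
proof (induction arbitrary: z rule: computes.induct)
  case (Zero xs)
  then show ?case by (auto elim: computes_ZeroE)
next
  case (Succ x)
  then show ?case by (auto elim: computes_SuccE)
next
  case (Proj i xs)
  then show ?case by (auto elim: computes_ProjE)
next
  case (Comp xs gs ys f u)
  from Comp.prems obtain vs where vs: "list_all2 (\<lambda>g y. computes g xs y) gs vs" "computes f vs z"
    by (auto elim: computes_CompE)
  have "vs = ys"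
    using Comp.IH(1) vs(1) by (auto simp: list_all2_conv_all_nth intro!: nth_equalityI)
  then show ?case
    using Comp.IH(2) vs(2) by blast
next
  case (PrimRec_0 f xs y g)
  from PrimRec_0.prems have "computes f xs z"
    by (rule computes_PrimRec_0E)
  then show ?case by (rule PrimRec_0.IH)
next
  case (PrimRec_Suc f g x xs y u)
  from PrimRec_Suc.prems obtain v where v: "computes (PrimRec f g) (x # xs) v"
    and z: "computes g (x # v # xs) z"
    by (rule computes_PrimRec_SucE)
  from v have "v = y" by (rule PrimRec_Suc.IH(1))
  with z show ?case by (intro PrimRec_Suc.IH(2)) simp
next
  case (Minim f x xs)
  from Minim.prems have z: "computes f (z # xs) 0" "\<forall>w<z. \<exists>y>0. computes f (w # xs) y"
    by (auto elim: computes_MinimE)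
  show ?case
  \<comment> \<open>The smaller candidate would be a zero of \<open>f\<close>, while the minimality
    condition of the larger one provides a positive value there. By induction one of these two
    values is unique.\<close>
  proof (cases z x rule: linorder_cases)
    case less
    then obtain y where "y > 0" and y: "\<And>v. computes f (z # xs) v \<Longrightarrow> v = y"
      using Minim.IH(2) by blast
    with y[OF z(1)] show ?thesis by simp
  next
    case greater
    then obtain y where "y > 0" and y: "computes f (x # xs) y"
      using z(2) by blast
    with Minim.IH(1)[OF y] show ?thesis by simp
  qed
qed

lemma computes_Proj: "i < length xs \<Longrightarrow> xs ! i = y \<Longrightarrow> computes (Proj i) xs y"
  using computes.Proj by blast

lemma computes_Comp1: "computes g xs y \<Longrightarrow> computes f [y] z \<Longrightarrow> computes (Comp f [g]) xs z"
  by (rule computes.Comp[where ys = "[y]"]) auto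

lemma computes_Comp2:
  "computes g xs y \<Longrightarrow> computes h xs y' \<Longrightarrow> computes f [y, y'] z \<Longrightarrow> computes (Comp f [g, h]) xs z"
  by (rule computes.Comp[where ys = "[y, y']"]) auto

lemma computes_Comp3:
  "computes g xs y \<Longrightarrow> computes h xs y' \<Longrightarrow> computes k xs y'' \<Longrightarrow> computes f [y, y', y''] z
    \<Longrightarrow> computes (Comp f [g, h, k]) xs z"
  by (rule computes.Comp[where ys = "[y, y', y'']"]) auto

text \<open>With a closed form \<open>F\<close> at hand, \<open>g\<close> has to be correct only
  when its second argument is the value of \<open>F\<close> reached so far.\<close>

lemma computes_PrimRec:
  assumes "computes f xs (F 0)" and "\<And>x. computes g (x # F x # xs) (F (Suc x))"
  shows "computes (PrimRec f g) (x # xs) (F x)"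
proof (induction x)
  case 0
  show ?case using assms(1) by (rule PrimRec_0)
next
  case (Suc x)
  show ?case using Suc assms(2) by (rule PrimRec_Suc)
qed

text \<open>Totality of \<open>f\<close> along \<open>xs\<close>, with values \<open>F\<close>,
  turns the side condition of \<open>Minim\<close> into a statement about numbers.\<close>

lemma computes_Minim:
  assumes "\<And>x. computes f (x # xs) (F x)" and "F x = 0" and "\<And>w. w < x \<Longrightarrow> F w \<noteq> 0"
  shows "computes (Minim f) xs x"
proof (rule Minim)
  show "computes f (x # xs) 0"
    using assms(1)[of x] assms(2) by simp
  show "\<forall>w<x. \<exists>y>0. computes f (w # xs) y"
    using assms(1,3) by blast
qed

section \<open>Arithmetic functions and bounded products\<close>

definition rec_add :: recf where
  "rec_add = PrimRec (Proj 0) (Comp Succ [Proj 1])"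

definition rec_mult :: recf where
  "rec_mult = PrimRec Zero (Comp rec_add [Proj 1, Proj 2])"

definition rec_pred :: recf where
  "rec_pred = PrimRec Zero (Proj 0)"

text \<open>Truncated subtraction with swapped arguments: primitive recursion runs on the first
  argument, which therefore has to be the subtrahend.\<close>

definition rec_rsub :: recf where
  "rec_rsub = PrimRec (Proj 0) (Comp rec_pred [Proj 1])"

text \<open>The absolute difference: one of the two truncated differences is always 0, and both are
  0 exactly at equality.\<close>

definition rec_dist :: recf where
  "rec_dist = Comp rec_add [Comp rec_rsub [Proj 0, Proj 1], Comp rec_rsub [Proj 1, Proj 0]]"

lemma computes_rec_add: "computes rec_add [x, y] (x + y)"
  unfolding rec_add_def
  by (rule computes_PrimRec[where F = "\<lambda>x. x + y"])
    (auto intro!: computes_Proj computes_Comp1[where y = "_ + y"] intro: computes.Succ)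

lemma computes_rec_mult: "computes rec_mult [x, y] (x * y)"
  unfolding rec_mult_def
proof (rule computes_PrimRec[where F = "\<lambda>x. x * y"])
  fix x
  show "computes (Comp rec_add [Proj 1, Proj 2]) [x, x * y, y] (Suc x * y)"
    using computes_rec_add[of "x * y" y]
    by (intro computes_Comp2[where y = "x * y" and y' = y] computes_Proj) (simp_all add: add.commute)
qed (simp add: computes.Zero)

lemma computes_rec_pred: "computes rec_pred [x] (x - 1)"
  unfolding rec_pred_def
  by (rule computes_PrimRec[where F = "\<lambda>x. x - 1"]) (auto intro!: computes_Proj computes.Zero)

lemma computes_rec_rsub: "computes rec_rsub [x, y] (y - x)"
  unfolding rec_rsub_def
proof (rule computes_PrimRec[where F = "\<lambda>x. y - x"])
  fix x
  show "computes (Comp rec_pred [Proj 1]) [x, y - x, y] (y - Suc x)"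
    using computes_rec_pred[of "y - x"]
    by (intro computes_Comp1[where y = "y - x"] computes_Proj) simp_all
qed (simp add: computes_Proj)

lemma computes_rec_dist: "computes rec_dist [x, y] ((y - x) + (x - y))"
  unfolding rec_dist_def
  by (intro computes_Comp2[where y = "y - x" and y' = "x - y"]
        computes_Comp2[where y = x and y' = y] computes_Comp2[where y = y and y' = x]
        computes_rec_add computes_rec_rsub computes_Proj) simp_all

text \<open>The factor \<open>g\<close> sees the counter, the partial product and the parameters, in
  this order; \<open>one\<close> supplies the empty product.\<close>

definition rec_prod :: "recf \<Rightarrow> recf \<Rightarrow> recf" where
  "rec_prod one g = PrimRec one (Comp rec_mult [Proj 1, g])"

lemma computes_rec_prod:
  assumes "\<And>x y. computes g (x # y # xs) (G x)"
  shows "computes (rec_prod (Comp Succ [Zero]) g) (m # xs) (\<Prod>x<m. G x)"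
  unfolding rec_prod_def
proof (rule computes_PrimRec[where F = "\<lambda>m. \<Prod>x<m. G x"])
  show "computes (Comp Succ [Zero]) xs (\<Prod>x<0. G x)"
    by (auto intro!: computes_Comp1 computes.Zero computes.Succ)
next
  fix m
  show "computes (Comp rec_mult [Proj 1, g]) (m # (\<Prod>x<m. G x) # xs) (\<Prod>x<Suc m. G x)"
    using computes_rec_mult[of "\<Prod>x<m. G x" "G m"] assms
    by (intro computes_Comp2[where y = "\<Prod>x<m. G x" and y' = "G m"] computes_Proj) simp_all
qed

text \<open>The projections are found by unbounded search for a common bound on \<open>a\<close> and \<open>b\<close>; bounded
  existential quantifiers are products of distances, which vanish iff some factor does.\<close>

lemma recursive_pairing_inverse:
  assumes "recursive_pairing J"
  obtains p q where "\<And>a b. computes p [J (a, b)] a" and "\<And>a b. computes q [J (a, b)] b"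
proof -
  from assms obtain j where j: "\<And>a b. computes j [a, b] (J (a, b))" and J: "bij J"
    by (auto simp: recursive_pairing_def recursive_fun2_def)
  have J_eq: "J (a, b) = J (a', b') \<longleftrightarrow> a = a' \<and> b = b'" for a b a' b'
    using J by (auto simp: bij_def dest: injD)
  define D where "D a b c = (c - J (a, b)) + (J (a, b) - c)" for a b c
  have D_0: "D a b c = 0 \<longleftrightarrow> J (a, b) = c" for a b c
    by (auto simp: D_def)
  define d where "d = Comp rec_dist [Comp j [Proj 0, Proj 1], Proj 2]"
  have d: "computes d [a, b, c] (D a b c)" for a b c
    unfolding d_def D_def
    by (intro computes_Comp2[where y = "J (a, b)" and y' = c] computes_Comp2[where y = a and y' = b]
          j computes_rec_dist computes_Proj) simp_all
  \<comment> \<open>Inside the recursion the arguments read \<open>b\<close>, partial product,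
    \<open>a\<close>, \<open>c\<close>; hence the positions 2, 0, 3. The same shift occurs in
    \<open>d2\<close>.\<close>
  define d1 where "d1 = rec_prod (Comp Succ [Zero]) (Comp d [Proj 2, Proj 0, Proj 3])"
  have d1: "computes d1 [v, a, c] (\<Prod>b<v. D a b c)" for v a c
    unfolding d1_def
    by (rule computes_rec_prod[where G = "\<lambda>b. D a b c"], rule computes_Comp3[OF _ _ _ d])
      (simp_all add: computes_Proj)
  define d2 where "d2 = rec_prod (Comp Succ [Zero]) (Comp d1 [Proj 2, Proj 0, Proj 3])"
  have d2: "computes d2 [u, v, c] (\<Prod>a<u. \<Prod>b<v. D a b c)" for u v c
    unfolding d2_def
    by (rule computes_rec_prod[where G = "\<lambda>a. \<Prod>b<v. D a b c"], rule computes_Comp3[OF _ _ _ d1])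
      (simp_all add: computes_Proj)
  define w where "w = Minim (Comp d2 [Proj 0, Proj 0, Proj 1])"
  \<comment> \<open>The products range strictly below their bounds, so the least bound that captures
    both components exceeds their maximum by one.\<close>
  define W where "W a b = Suc (max a b)" for a b :: nat
  have w: "computes w [J (a, b)] (W a b)" for a b
    unfolding w_def
  proof (rule computes_Minim)
    show "computes (Comp d2 [Proj 0, Proj 0, Proj 1]) [x, J (a, b)]
        (\<Prod>a'<x. \<Prod>b'<x. D a' b' (J (a, b)))" for x
      by (rule computes_Comp3[OF _ _ _ d2]) (simp_all add: computes_Proj)
  qed (auto simp: D_0 J_eq W_def)
  \<comment> \<open>With the bound known, \<open>a\<close> is the least number that has a partner
    below the bound; injectivity of \<open>J\<close> excludes any other.\<close>
  define p where "p = Comp (Minim (Comp d1 [Proj 1, Proj 0, Proj 2])) [w, Proj 0]"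
  have "computes (Minim (Comp d1 [Proj 1, Proj 0, Proj 2])) [W a b, J (a, b)] a" for a b
  proof (rule computes_Minim)
    show "computes (Comp d1 [Proj 1, Proj 0, Proj 2]) [x, W a b, J (a, b)]
        (\<Prod>b'<W a b. D x b' (J (a, b)))" for x
      by (rule computes_Comp3[OF _ _ _ d1]) (simp_all add: computes_Proj)
  qed (auto simp: D_0 J_eq W_def)
  then have p: "computes p [J (a, b)] a" for a b
    unfolding p_def by (intro computes_Comp2[OF w computes_Proj]) simp_all
  \<comment> \<open>With \<open>a\<close> known, \<open>b\<close> can be searched for directly,
    without a bound.\<close>
  define q where "q = Comp (Minim (Comp d [Proj 1, Proj 0, Proj 2])) [p, Proj 0]"
  have "computes (Minim (Comp d [Proj 1, Proj 0, Proj 2])) [a, J (a, b)] b" for a b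
  proof (rule computes_Minim)
    show "computes (Comp d [Proj 1, Proj 0, Proj 2]) [x, a, J (a, b)] (D a x (J (a, b)))" for x
      by (rule computes_Comp3[OF _ _ _ d]) (simp_all add: computes_Proj)
  qed (auto simp: D_0 J_eq)
  then have "computes q [J (a, b)] b" for a b
    unfolding q_def by (intro computes_Comp2[OF p computes_Proj]) simp_all
  with p show thesis by (rule that)
qed

section \<open>Coding the first two entries of a relation into one\<close>

definition pair_up :: "(nat \<times> nat \<Rightarrow> nat) \<Rightarrow> nat list set \<Rightarrow> nat list set" where
  "pair_up J M = {J (a, b) # r | a b r. a # b # r \<in> M}"

lemma pair_up_iff: "inj J \<Longrightarrow> J (a, b) # r \<in> pair_up J M \<longleftrightarrow> a # b # r \<in> M"
  by (auto simp: pair_up_def dest: injD)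

text \<open>The first entry is decoded by the two inverses of \<open>J\<close>, and the code for
  \<open>M\<close> is run on the lengthened list. Surjectivity of \<open>J\<close> makes every first
  entry decodable.\<close>

lemma re_rel_pair_up:
  assumes J: "recursive_pairing J" and M: "re_rel (Suc n) M" and n: "n \<ge> 1"
  shows "re_rel n (pair_up J M)"
proof -
  obtain p q where p: "\<And>a b. computes p [J (a, b)] a" and q: "\<And>a b. computes q [J (a, b)] b"
    using recursive_pairing_inverse[OF J] by blast
  from J have bij: "bij J" by (simp add: recursive_pairing_def)
  from M obtain f where len: "\<And>xs. xs \<in> M \<Longrightarrow> length xs = Suc n"
    and f: "\<And>xs. length xs = Suc n \<Longrightarrow> xs \<in> M \<longleftrightarrow> (\<exists>y. computes f xs y)"
    by (auto simp: re_rel_def)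
  define gs where "gs = Comp p [Proj 0] # Comp q [Proj 0] # map Proj [1..<n]"
  have "xs \<in> pair_up J M \<longleftrightarrow> (\<exists>y. computes (Comp f gs) xs y)" if xs: "length xs = n" for xs
  proof -
    from xs n obtain c r where cr: "xs = c # r"
      by (cases xs) auto
    from bij obtain a b where c: "c = J (a, b)"
      by (metis bij_pointE surj_pair)
    have "list_all2 (\<lambda>g y. computes g xs y) (map Proj [1..<n]) r"
      using xs by (auto simp: list_all2_conv_all_nth cr simp del: upt_Suc intro: computes_Proj)
    moreover have "computes (Comp p [Proj 0]) xs a" "computes (Comp q [Proj 0]) xs b"
      using computes_Comp1[OF computes_Proj p] computes_Comp1[OF computes_Proj q] by (simp_all add: cr c)
    ultimately have gs: "list_all2 (\<lambda>g y. computes g xs y) gs (a # b # r)"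
      by (simp add: gs_def)
    \<comment> \<open>If the composition converges, it does so through some list of intermediate
      values; by determinism this is the decoded list, so \<open>f\<close> converges there.\<close>
    have gs_unique: "ys = a # b # r" if ys: "list_all2 (\<lambda>g y. computes g xs y) gs ys" for ys
    proof (rule nth_equalityI)
      show "length ys = length (a # b # r)"
        using ys gs by (metis list_all2_lengthD)
      show "ys ! i = (a # b # r) ! i" if "i < length ys" for i
        using that ys gs by (metis computes_deterministic list_all2_conv_all_nth)
    qed
    have "(\<exists>y. computes (Comp f gs) xs y) \<longleftrightarrow> (\<exists>y. computes f (a # b # r) y)"
      using gs gs_unique by (metis computes.Comp computes_CompE)
    also have "\<dots> \<longleftrightarrow> a # b # r \<in> M"
      using f[of "a # b # r"] xs cr by simp
    also have "\<dots> \<longleftrightarrow> xs \<in> pair_up J M"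
      using bij by (simp add: cr c pair_up_iff bij_is_inj)
    finally show ?thesis by simp
  qed
  moreover have "\<forall>xs\<in>pair_up J M. length xs = n"
    by (auto simp: pair_up_def dest!: len)
  ultimately show ?thesis
    unfolding re_rel_def by blast
qed


section \<open>Renaming of variables\<close>

text \<open>Numerals enter as formulas rather than terms, so it suffices to put variables for
  variables. This special case of \<open>subst\<close> composes like functions do.\<close>

definition rename :: "(nat \<Rightarrow> nat) \<Rightarrow> fm \<Rightarrow> fm" where
  "rename f p = subst (\<lambda>i. Var (f i)) p"

text \<open>The counterpart of \<open>under_binder\<close> for renamings.\<close>

definition lift_ren :: "(nat \<Rightarrow> nat) \<Rightarrow> nat \<Rightarrow> nat" where
  "lift_ren f = case_nat 0 (\<lambda>i. Suc (f i))"

lemma lift_ren_simps [simp]: "lift_ren f 0 = 0" "lift_ren f (Suc i) = Suc (f i)"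
  by (simp_all add: lift_ren_def)

lemma rename_simps [simp]:
  "rename f Falsum = Falsum"
  "rename f (Equal s t) = Equal (subst_tm (\<lambda>i. Var (f i)) s) (subst_tm (\<lambda>i. Var (f i)) t)"
  "rename f (Pred r ts) = Pred r (map (subst_tm (\<lambda>i. Var (f i))) ts)"
  "rename f (Implies p q) = Implies (rename f p) (rename f q)"
  "rename f (Forall p) = Forall (rename (lift_ren f) p)"
proof -
  have "under_binder (\<lambda>i. Var (f i)) = (\<lambda>i. Var (lift_ren f i))"
    by (auto simp: under_binder_def fun_eq_iff split: nat.split)
  then show "rename f (Forall p) = Forall (rename (lift_ren f) p)"
    by (simp add: rename_def)
qed (simp_all add: rename_def)

lemma lift_eq_rename: "lift p = rename Suc p"
  by (simp add: lift_def rename_def)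

lemma inst_eq_rename: "inst (Var k) p = rename (case_nat k id) p"
  unfolding inst_def rename_def
  by (rule arg_cong[where f = "\<lambda>\<sigma>. subst \<sigma> p"]) (auto simp: fun_eq_iff split: nat.split)

lemma at_vars_eq_rename: "at_vars p vs = rename ((!) vs) p"
  by (simp add: at_vars_def rename_def)

lemma fv_tm_rename: "fv_tm (subst_tm (\<lambda>i. Var (f i)) t) = f ` fv_tm t"
  by (induction t) auto

lemma Suc_in_lift_ren_image: "Suc i \<in> lift_ren f ` X \<longleftrightarrow> i \<in> f ` {n. Suc n \<in> X}"
proof
  assume "Suc i \<in> lift_ren f ` X"
  then obtain j where "j \<in> X" "Suc i = lift_ren f j" by blast
  then show "i \<in> f ` {n. Suc n \<in> X}" by (cases j) auto
next
  assume "i \<in> f ` {n. Suc n \<in> X}"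
  then show "Suc i \<in> lift_ren f ` X" by (auto intro: image_eqI[where x = "Suc _"])
qed

lemma fv_rename: "fv (rename f p) = f ` fv p"
  by (induction p arbitrary: f)
    (simp_all add: fv_tm_rename image_Un image_Union image_image Suc_in_lift_ren_image)

lemma wf_tm_rename: "wf_tm L (subst_tm (\<lambda>i. Var (f i)) t) \<longleftrightarrow> wf_tm L t"
  by (induction t) (auto simp: list_all_iff)

lemma wf_fm_rename [simp]: "wf_fm L (rename f p) \<longleftrightarrow> wf_fm L p"
  by (induction p arbitrary: f) (auto simp: wf_tm_rename list_all_iff)

lemma subst_tm_comp_rename:
  "subst_tm (\<lambda>i. Var (f i)) (subst_tm (\<lambda>i. Var (g i)) t) = subst_tm (\<lambda>i. Var (f (g i))) t"
  by (induction t) auto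

lemma rename_rename: "rename f (rename g p) = rename (f \<circ> g) p"
proof (induction p arbitrary: f g)
  case (Forall p)
  have "lift_ren f \<circ> lift_ren g = lift_ren (f \<circ> g)"
    by (auto simp: lift_ren_def fun_eq_iff split: nat.split)
  with Forall show ?case by (simp del: o_apply)
qed (simp_all add: subst_tm_comp_rename)

lemma subst_tm_cong: "(\<And>i. i \<in> fv_tm t \<Longrightarrow> \<sigma> i = \<tau> i) \<Longrightarrow> subst_tm \<sigma> t = subst_tm \<tau> t"
  by (induction t) auto

lemma rename_cong: "(\<And>i. i \<in> fv p \<Longrightarrow> f i = g i) \<Longrightarrow> rename f p = rename g p"
proof (induction p arbitrary: f g)
  case (Equal s t)
  then show ?case by (auto intro!: subst_tm_cong)
next
  case (Pred r ts)
  then show ?case by (auto intro!: subst_tm_cong)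
next
  case (Implies p q)
  then show ?case by (metis UnCI fv.simps(4) rename_simps(4))
next
  case (Forall p)
  have "lift_ren f i = lift_ren g i" if "i \<in> fv p" for i
    using that Forall.prems by (cases i) auto
  then show ?case using Forall.IH[of "lift_ren f" "lift_ren g"] by simp
qed auto

lemma rename_id: "(\<And>i. i \<in> fv p \<Longrightarrow> f i = i) \<Longrightarrow> rename f p = p"
proof -
  have tm: "subst_tm Var t = t" for t
    by (induction t) (auto intro: map_idI)
  have "lift_ren (\<lambda>i. i) = (\<lambda>i. i)"
    by (auto simp: lift_ren_def fun_eq_iff split: nat.split)
  then have "rename (\<lambda>i. i) p = p" for p
    by (induction p) (auto simp: tm intro: map_idI)
  then show "(\<And>i. i \<in> fv p \<Longrightarrow> f i = i) \<Longrightarrow> rename f p = p"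
    by (metis rename_cong)
qed


section \<open>Derived rules\<close>

text \<open>Contexts matter only as sets, so this also covers exchange and contraction. Subset
  inclusion survives the lifting of contexts in \<open>AllI\<close>.\<close>

lemma derives_weaken: "derives T \<Gamma> p \<Longrightarrow> set \<Gamma> \<subseteq> set \<Delta> \<Longrightarrow> derives T \<Delta> p"
proof (induction arbitrary: \<Delta> rule: derives.induct)
  case (Axiom p \<Gamma>)
  then show ?case by (intro derives.Axiom)
next
  case (Assm p \<Gamma>)
  then show ?case by (intro derives.Assm) auto
next
  case (ImpI p \<Gamma> q)
  from ImpI.prems have "derives T (p # \<Delta>) q" by (intro ImpI.IH) auto
  then show ?case using ImpI.hyps(2) by (rule derives.ImpI)
next
  case (ImpE \<Gamma> p q)
  then show ?case by (meson derives.ImpE)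
next
  case (RAA p \<Gamma>)
  from RAA.prems have "derives T (Neg p # \<Delta>) Falsum" by (intro RAA.IH) auto
  then show ?case using RAA.hyps(2) by (rule derives.RAA)
next
  case (AllI \<Gamma> p)
  from AllI.prems have "derives T (map lift \<Delta>) p" by (intro AllI.IH) auto
  then show ?case by (rule derives.AllI)
next
  case (AllE \<Gamma> p t)
  then show ?case by (intro derives.AllE) auto
next
  case (Refl t \<Gamma>)
  then show ?case by (intro derives.Refl)
next
  case (Leibniz \<Gamma> s t p)
  then show ?case by (meson derives.Leibniz)
qed

lemma derives_theorem: "T \<turnstile> p \<Longrightarrow> derives T \<Gamma> p"
  unfolding proves_def by (erule derives_weaken) simp

lemma derives_Cons: "derives T \<Gamma> p \<Longrightarrow> derives T (q # \<Gamma>) p"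
  by (erule derives_weaken) auto

lemma derives_FalsumE: "derives T \<Gamma> Falsum \<Longrightarrow> wf_fm (lang_of T) p \<Longrightarrow> derives T \<Gamma> p"
  by (rule derives.RAA[OF derives_Cons])

text \<open>\<open>And\<close> abbreviates a negated implication, so its rules are classical
  derivations; the well-formedness premises come from \<open>ImpI\<close> and
  \<open>RAA\<close>.\<close>

lemma derives_AndI:
  assumes "derives T \<Gamma> p" and "derives T \<Gamma> q" and "wf_fm (lang_of T) p" and "wf_fm (lang_of T) q"
  shows "derives T \<Gamma> (And p q)"
proof -
  let ?r = "Implies p (Neg q)"
  have "derives T (?r # \<Gamma>) ?r"
    using assms by (intro derives.Assm) auto
  then have "derives T (?r # \<Gamma>) Falsum"
    using assms by (meson derives.ImpE derives_Cons)
  then show ?thesis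
    using assms by (intro derives.ImpI) auto
qed

lemma derives_AndD1:
  assumes "derives T \<Gamma> (And p q)" and "wf_fm (lang_of T) p" and "wf_fm (lang_of T) q"
  shows "derives T \<Gamma> p"
proof (rule derives.RAA)
  have "derives T (p # Neg p # \<Gamma>) Falsum"
    using assms by (intro derives.ImpE[of T _ p Falsum] derives.Assm) auto
  then have "derives T (p # Neg p # \<Gamma>) (Neg q)"
    by (rule derives_FalsumE) (use assms in simp)
  then have "derives T (Neg p # \<Gamma>) (Implies p (Neg q))"
    using assms(2) by (rule derives.ImpI)
  then show "derives T (Neg p # \<Gamma>) Falsum"
    using assms(1) by (meson derives.ImpE derives_Cons)
qed fact

lemma derives_AndD2:
  assumes "derives T \<Gamma> (And p q)" and "wf_fm (lang_of T) p" and "wf_fm (lang_of T) q"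
  shows "derives T \<Gamma> q"
proof (rule derives.RAA)
  have "derives T (p # Neg q # \<Gamma>) (Neg q)"
    using assms by (intro derives.Assm) auto
  then have "derives T (Neg q # \<Gamma>) (Implies p (Neg q))"
    using assms(2) by (rule derives.ImpI)
  then show "derives T (Neg q # \<Gamma>) Falsum"
    using assms(1) by (meson derives.ImpE derives_Cons)
qed fact

text \<open>Witnesses are always variables here: \<open>case_nat k id\<close> puts \<open>k\<close>
  for the bound index 0 and lowers the others by one.\<close>

lemma derives_ExI:
  assumes "derives T \<Gamma> (rename (case_nat k id) p)" and "wf_fm (lang_of T) p"
  shows "derives T \<Gamma> (Exists p)"
proof (rule derives.ImpI)
  let ?q = "Forall (Neg p)"
  have "derives T (?q # \<Gamma>) ?q"
    using assms by (intro derives.Assm) auto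
  then have "derives T (?q # \<Gamma>) (inst (Var k) (Neg p))"
    by (rule derives.AllE) simp
  then have "derives T (?q # \<Gamma>) (Neg (rename (case_nat k id) p))"
    by (simp add: inst_eq_rename)
  then show "derives T (?q # \<Gamma>) Falsum"
    using assms(1) by (meson derives.ImpE derives_Cons)
qed (use assms in simp)

text \<open>The eigenvariable is index 0; shifting the context and the conclusion by
  \<open>Suc\<close> expresses that it is fresh for them.\<close>

lemma derives_ExE:
  assumes "derives T \<Gamma> (Exists p)" and "derives T (p # map (rename Suc) \<Gamma>) (rename Suc q)"
    and "wf_fm (lang_of T) p" and "wf_fm (lang_of T) q"
  shows "derives T \<Gamma> q"
proof (rule derives.RAA)
  let ?\<Delta> = "p # Neg (rename Suc q) # map (rename Suc) \<Gamma>"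
  have "derives T ?\<Delta> (rename Suc q)"
    using assms(2) by (rule derives_weaken) auto
  moreover have "derives T ?\<Delta> (Neg (rename Suc q))"
    using assms by (intro derives.Assm) auto
  ultimately have "derives T ?\<Delta> Falsum"
    by (meson derives.ImpE)
  then have "derives T (Neg (rename Suc q) # map (rename Suc) \<Gamma>) (Neg p)"
    using assms by (intro derives.ImpI) auto
  then have "derives T (Neg q # \<Gamma>) (Forall (Neg p))"
    by (intro derives.AllI) (simp add: lift_eq_rename[abs_def])
  then show "derives T (Neg q # \<Gamma>) Falsum"
    using assms(1) by (meson derives.ImpE derives_Cons)
qed fact

lemma proves_mp: "T \<turnstile> Implies p q \<Longrightarrow> derives T \<Gamma> p \<Longrightarrow> derives T \<Gamma> q"
  by (meson derives.ImpE derives_theorem)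

lemma proves_contrapos:
  assumes "T \<turnstile> Implies p q" and "T \<turnstile> Neg q" and "wf_fm (lang_of T) p"
  shows "T \<turnstile> Neg p"
proof -
  have "derives T [p] p"
    using assms(3) by (intro derives.Assm) auto
  then have "derives T [p] Falsum"
    by (rule proves_mp[OF assms(2) proves_mp[OF assms(1)]])
  then show ?thesis
    using assms(3) unfolding proves_def by (rule derives.ImpI)
qed

text \<open>An assumption may sit in the context under another renaming, as long as the two agree on
  its free variables.\<close>

lemma derives_rename_Assm:
  assumes "rename g p \<in> set \<Gamma>" and "wf_fm (lang_of T) p" and "\<And>i. i \<in> fv p \<Longrightarrow> f i = g i"
  shows "derives T \<Gamma> (rename f p)"
proof -
  have "rename f p = rename g p"
    using assms(3) by (rule rename_cong)
  then show ?thesis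
    using assms(1,2) by (simp add: derives.Assm)
qed

text \<open>Existential elimination without a context. With \<open>p\<close> as the first premise,
  the conclusion of one application has the form of the premise of the next, so nested quantifiers
  are eliminated from the inside out.\<close>

lemma proves_Exists_And_Implies:
  assumes "T \<turnstile> Implies p (Implies r (rename Suc q))"
    and wf: "wf_fm (lang_of T) r" "wf_fm (lang_of T) p" "wf_fm (lang_of T) q"
  shows "T \<turnstile> Implies (Exists (And r p)) q"
  unfolding proves_def
proof (rule derives.ImpI)
  let ?\<Gamma> = "And r p # map (rename Suc) [Exists (And r p)]"
  have rp: "derives T ?\<Gamma> (And r p)"
    using wf by (intro derives.Assm) auto
  have "derives T ?\<Gamma> p" and "derives T ?\<Gamma> r"
    using derives_AndD1[OF rp] derives_AndD2[OF rp] wf by blast+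
  then have "derives T ?\<Gamma> (rename Suc q)"
    using derives.ImpE proves_mp[OF assms(1)] by blast
  moreover have "derives T [Exists (And r p)] (Exists (And r p))"
    using wf by (intro derives.Assm) auto
  ultimately show "derives T [Exists (And r p)] q"
    using wf by (metis derives_ExE wf_fm.simps(1,4))
qed (use wf in simp)

text \<open>Existential introduction below a renaming \<open>f\<close>: the witness is merely
  prepended to \<open>f\<close>, so nested quantifiers need no explicit composition of
  renamings.\<close>

lemma derives_rename_Exists_And:
  assumes "derives T \<Gamma> (rename (case_nat k f) p)" and "derives T \<Gamma> (rename (case_nat k f) q)"
    and wf: "wf_fm (lang_of T) p" "wf_fm (lang_of T) q"
  shows "derives T \<Gamma> (rename f (Exists (And p q)))"
proof -
  have "case_nat k id \<circ> lift_ren f = case_nat k f"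
    by (auto simp: lift_ren_def fun_eq_iff split: nat.split)
  then have "rename (case_nat k id) (rename (lift_ren f) (And p q))
      = And (rename (case_nat k f) p) (rename (case_nat k f) q)"
    by (simp add: rename_rename)
  with assms have "derives T \<Gamma> (rename (case_nat k id) (rename (lift_ren f) (And p q)))"
    by (simp only: wf_fm_rename derives_AndI)
  then have "derives T \<Gamma> (Exists (rename (lift_ren f) (And p q)))"
    by (rule derives_ExI) (use wf in simp)
  then show ?thesis
    by simp
qed

lemma proves_Exists_And_mono:
  assumes "T \<turnstile> Implies p q" and wf: "wf_fm (lang_of T) r" "wf_fm (lang_of T) p" "wf_fm (lang_of T) q"
  shows "T \<turnstile> Implies (Exists (And r p)) (Exists (And r q))"
proof (rule proves_Exists_And_Implies)
  have "derives T [r, p] q" and "derives T [r, p] r"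
    using wf by (auto intro!: proves_mp[OF assms(1)] derives.Assm)
  \<comment> \<open>The eigenvariable itself serves as the witness, so eliminating and reintroducing
    the quantifier amounts to the identity renaming.\<close>
  moreover have "rename (case_nat 0 Suc) s = s" for s
    by (rule rename_id) (simp split: nat.split)
  ultimately have "derives T [r, p] (rename Suc (Exists (And r q)))"
    using wf by (intro derives_rename_Exists_And[where k = 0]) simp_all
  then show "T \<turnstile> Implies p (Implies r (rename Suc (Exists (And r q))))"
    using wf unfolding proves_def by (intro derives.ImpI)
qed (use wf in simp_all)


section \<open>Numerals\<close>

lemma fv_at_vars: "fv (at_vars p vs) = (!) vs ` fv p"
  by (simp add: at_vars_eq_rename fv_rename)

lemma wf_fm_at_vars [simp]: "wf_fm L (at_vars p vs) \<longleftrightarrow> wf_fm L p"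
  by (simp add: at_vars_eq_rename)

context
  fixes I :: translation and L :: lang
  assumes I: "is_translation I (lang_of Num) L"
begin

lemma wf_fm_tr_numeral: "wf_fm L (tr_tm I (numeral_tm a) \<rho> v)"
  using I by (induction a arbitrary: \<rho> v) (auto simp: is_translation_def Num_def)

lemma fv_tr_numeral: "fv (tr_tm I (numeral_tm a) \<rho> v) \<subseteq> {v}"
proof (induction a arbitrary: \<rho> v)
  case 0
  have "fv (tr_fun I 0 0) \<subseteq> {0}"
    using I by (auto simp: is_translation_def Num_def)
  then show ?case by (auto simp: fv_at_vars)
next
  case (Suc a)
  have "fv (tr_dom I) \<subseteq> {0}" "fv (tr_fun I 1 1) \<subseteq> {..1}"
    using I by (auto simp: is_translation_def Num_def)
  \<comment> \<open>The predecessor numeral is bound as index 0, so the value index \<open>v\<close>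
    reads \<open>Suc v\<close> inside the quantifier.\<close>
  then have "fv (at_vars (tr_dom I) [0]) \<subseteq> {0}"
    "fv (at_vars (tr_fun I 1 1) [0, Suc v]) \<subseteq> {0, Suc v}"
    by (auto simp: fv_at_vars nth_Cons' subset_iff)
  with Suc[of "\<lambda>n. Suc (\<rho> n)" 0] show ?case by auto
qed

lemma wf_fm_is_numeral: "wf_fm L (is_numeral I a)"
  using I wf_fm_tr_numeral by (simp add: is_numeral_def is_translation_def)

lemma fv_is_numeral: "fv (is_numeral I a) \<subseteq> {0}"
  using I fv_tr_numeral[of a id 0] by (auto simp: is_numeral_def is_translation_def fv_at_vars)

lemma wf_fm_at_numerals: "wf_fm L p \<Longrightarrow> wf_fm L (at_numerals I as p)"
  using wf_fm_is_numeral by (induction as arbitrary: p) auto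

end

text \<open>Carries an implication about the first entries through the quantifiers for the remaining
  ones.\<close>

lemma proves_at_numerals_mono:
  assumes "is_translation I (lang_of Num) (lang_of T)"
  shows "T \<turnstile> Implies p q \<Longrightarrow> wf_fm (lang_of T) p \<Longrightarrow> wf_fm (lang_of T) q
    \<Longrightarrow> T \<turnstile> Implies (at_numerals I as p) (at_numerals I as q)"
proof (induction as arbitrary: p q)
  case (Cons a as)
  then show ?case
    using wf_fm_is_numeral[OF assms] by (simp add: proves_Exists_And_mono)
qed simp


section \<open>Substituting a definable function\<close>

text \<open>\<open>subst_value \<theta> \<phi>\<close> is \<open>\<exists>z. \<theta>(x0, x1, z) \<and> \<phi>(z, x2, x3, \<dots>)\<close>; the trivial equations
  make sure that \<open>x0\<close> and \<open>x1\<close> occur.\<close>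

definition subst_value :: "fm \<Rightarrow> fm \<Rightarrow> fm" where
  "subst_value \<theta> \<phi> = Exists (And (And (Equal (Var 1) (Var 1)) (Equal (Var 2) (Var 2)))
     (And (rename ((!) [1, 2, 0]) \<theta>) (rename (case_nat 0 (\<lambda>i. i + 3)) \<phi>)))"

lemma wf_fm_subst_value: "wf_fm L \<theta> \<Longrightarrow> wf_fm L \<phi> \<Longrightarrow> wf_fm L (subst_value \<theta> \<phi>)"
  by (simp add: subst_value_def)

text \<open>Exact separation asks for exactly \<open>n + 1\<close> free variables: the equations
  contribute 0 and 1, and \<open>\<phi>\<close> contributes the rest.\<close>

lemma fv_subst_value:
  assumes "fv \<theta> \<subseteq> {0, 1, 2}" and "fv \<phi> = {..<n}" and "n \<ge> 1"
  shows "fv (subst_value \<theta> \<phi>) = {..<n + 1}"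
proof -
  have "(!) [1, 2, 0] ` fv \<theta> \<subseteq> {0, 1, 2 :: nat}"
    using assms(1) by auto
  \<comment> \<open>Variable \<open>i + 1\<close> of \<open>\<phi>\<close> becomes
    \<open>i + 3\<close> below the quantifier, hence \<open>i + 2\<close> outside; variable 0
    becomes the bound \<open>z\<close>.\<close>
  moreover have "(Suc m \<in> case_nat 0 (\<lambda>i. i + 3) ` {..<n}) \<longleftrightarrow> 2 \<le> m \<and> m < n + 1" for m
  proof
    assume "Suc m \<in> case_nat 0 (\<lambda>i. i + 3) ` {..<n}"
    then show "2 \<le> m \<and> m < n + 1" by (auto split: nat.splits)
  next
    assume m: "2 \<le> m \<and> m < n + 1"
    then have "Suc m = case_nat 0 (\<lambda>i. i + 3) (Suc (m - 2))" by simp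
    moreover have "Suc (m - 2) \<in> {..<n}" using m by auto
    ultimately show "Suc m \<in> case_nat 0 (\<lambda>i. i + 3) ` {..<n}" by (rule image_eqI)
  qed
  ultimately show ?thesis
    using assms(2,3) by (fastforce simp: subst_value_def fv_rename)
qed

text \<open>Stripping all quantifiers leaves \<open>\<theta>\<close> at numerals of \<open>a\<close>
  and \<open>b\<close>; definability then makes \<open>z\<close> a numeral of \<open>c\<close>, so
  \<open>z\<close> witnesses the conclusion.\<close>

lemma Implies_at_numerals_subst_value:
  assumes I: "is_translation I (lang_of Num) (lang_of T)"
    and \<theta>: "wf_fm (lang_of T) \<theta>" "fv \<theta> \<subseteq> {0, 1, 2}" and \<phi>: "wf_fm (lang_of T) \<phi>"
    and definable: "T \<turnstile> Implies (at_numerals I [a, b] \<theta>) (is_numeral I c)"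
  shows "T \<turnstile> Implies (at_numerals I [a, b] (subst_value \<theta> \<phi>)) (at_numerals I [c] \<phi>)"
proof -
  define A B C where "A = is_numeral I a" and "B = is_numeral I b" and "C = is_numeral I c"
  note num_defs = A_def B_def C_def
  have wf: "wf_fm (lang_of T) A" "wf_fm (lang_of T) B" "wf_fm (lang_of T) C"
    unfolding num_defs by (rule wf_fm_is_numeral[OF I])+
  have fv: "i \<in> fv A \<Longrightarrow> i = 0" "i \<in> fv B \<Longrightarrow> i = 0" "i \<in> fv C \<Longrightarrow> i = 0" for i
    unfolding num_defs using fv_is_numeral[OF I] by blast+
  have fv_\<theta>: "i \<in> fv \<theta> \<Longrightarrow> i = 0 \<or> i = 1 \<or> i = 2" for i
    using \<theta>(2) by blast
  let ?\<theta> = "rename ((!) [1, 2, 0]) \<theta>" and ?\<phi> = "rename (case_nat 0 (\<lambda>i. i + 3)) \<phi>"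
  let ?D = "And (Equal (Var 1) (Var 1)) (Equal (Var 2) (Var 2))"
  let ?Suc3 = "Suc \<circ> Suc \<circ> Suc"
  define R where "R = Exists (And C \<phi>)"
  have wf_R: "wf_fm (lang_of T) R"
    using wf \<phi> by (simp add: R_def)
  \<comment> \<open>With all three quantifiers stripped, index 0 is \<open>z\<close>, index 1 is
    \<open>x0\<close> and index 2 is \<open>x1\<close>.\<close>
  let ?\<Gamma> = "[rename (Suc \<circ> Suc) B, rename Suc A, ?D, And ?\<theta> ?\<phi>]"
  have "derives T ?\<Gamma> (And ?\<theta> ?\<phi>)"
    using \<theta> \<phi> by (intro derives.Assm) auto
  then have \<theta>': "derives T ?\<Gamma> ?\<theta>" and \<phi>': "derives T ?\<Gamma> ?\<phi>"
    using \<theta> \<phi> by (auto intro: derives_AndD1 derives_AndD2)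
  \<comment> \<open>Rebuilding \<open>at_numerals I [a, b] \<theta>\<close> takes witness 2 for the
    outer quantifier and 1 for the inner one; variable 2 of \<open>\<theta>\<close> then falls on
    \<open>z\<close>.\<close>
  have "rename (case_nat 1 (case_nat 2 id)) \<theta> = ?\<theta>"
    by (rule rename_cong) (auto dest!: fv_\<theta> simp: eval_nat_numeral)
  moreover have "derives T ?\<Gamma> (rename (case_nat 1 (case_nat 2 id)) A)"
    by (rule derives_rename_Assm[where g = Suc]) (auto simp: wf dest: fv)
  moreover have "derives T ?\<Gamma> (rename (case_nat 2 id) B)"
    by (rule derives_rename_Assm[where g = "Suc \<circ> Suc"]) (auto simp: wf dest: fv)
  ultimately have "derives T ?\<Gamma> (rename id (Exists (And B (Exists (And A \<theta>)))))"
    using wf \<theta> \<theta>'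
    by (intro derives_rename_Exists_And[where k = 2] derives_rename_Exists_And[where k = 1]) simp_all
  then have "derives T ?\<Gamma> C"
    using proves_mp[OF definable] by (simp only: rename_id id_apply at_numerals.simps num_defs)
  moreover have "rename (case_nat 0 ?Suc3) C = C"
    by (rule rename_id) (auto dest: fv)
  moreover have "rename (case_nat 0 ?Suc3) \<phi> = ?\<phi>"
    by (rule rename_cong) (auto split: nat.split)
  \<comment> \<open>\<open>R\<close> stands outside the three stripped quantifiers, whence the
    threefold shift; its witness is \<open>z\<close>.\<close>
  ultimately have "derives T ?\<Gamma> (rename ?Suc3 R)"
    using wf \<phi> \<phi>' unfolding R_def by (intro derives_rename_Exists_And[where k = 0]) simp_all
  then have "T \<turnstile> Implies (And ?\<theta> ?\<phi>) (Implies ?D (Implies (rename Suc A)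
      (Implies (rename (Suc \<circ> Suc) B) (rename ?Suc3 R))))"
    unfolding proves_def by (intro derives.ImpI) (use wf \<theta> \<phi> in simp_all)
  \<comment> \<open>Nesting the shifts prepares the elimination of \<open>z\<close>,
    \<open>x0\<close> and \<open>x1\<close>, in this order.\<close>
  then have "T \<turnstile> Implies (And ?\<theta> ?\<phi>) (Implies ?D (rename Suc (Implies A (rename Suc
      (Implies B (rename Suc R))))))"
    by (simp only: rename_simps(4) rename_rename o_assoc)
  then have "T \<turnstile> Implies (subst_value \<theta> \<phi>) (Implies A (rename Suc (Implies B (rename Suc R))))"
    unfolding subst_value_def by (rule proves_Exists_And_Implies) (use wf wf_R \<theta> \<phi> in simp_all)
  then have "T \<turnstile> Implies (Exists (And A (subst_value \<theta> \<phi>))) (Implies B (rename Suc R))"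
    by (rule proves_Exists_And_Implies) (use wf wf_R \<theta> \<phi> in \<open>simp_all add: wf_fm_subst_value\<close>)
  then have "T \<turnstile> Implies (Exists (And B (Exists (And A (subst_value \<theta> \<phi>))))) R"
    by (rule proves_Exists_And_Implies) (use wf wf_R \<theta> \<phi> in \<open>simp_all add: wf_fm_subst_value\<close>)
  then show ?thesis
    by (simp only: at_numerals.simps num_defs R_def)
qed

text \<open>Here the numeral \<open>z\<close> of \<open>c\<close> is given, and definability
  supplies \<open>x0\<close> and \<open>x1\<close>; the quantifiers are then reintroduced in the
  other order.\<close>

lemma at_numerals_subst_value_Implies:
  assumes I: "is_translation I (lang_of Num) (lang_of T)"
    and \<theta>: "wf_fm (lang_of T) \<theta>" "fv \<theta> \<subseteq> {0, 1, 2}" and \<phi>: "wf_fm (lang_of T) \<phi>"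
    and definable: "T \<turnstile> Implies (is_numeral I c) (at_numerals I [a, b] \<theta>)"
  shows "T \<turnstile> Implies (at_numerals I [c] \<phi>) (at_numerals I [a, b] (subst_value \<theta> \<phi>))"
proof -
  define A B C where "A = is_numeral I a" and "B = is_numeral I b" and "C = is_numeral I c"
  note num_defs = A_def B_def C_def
  have wf: "wf_fm (lang_of T) A" "wf_fm (lang_of T) B" "wf_fm (lang_of T) C"
    unfolding num_defs by (rule wf_fm_is_numeral[OF I])+
  have fv: "i \<in> fv A \<Longrightarrow> i = 0" "i \<in> fv B \<Longrightarrow> i = 0" "i \<in> fv C \<Longrightarrow> i = 0" for i
    unfolding num_defs using fv_is_numeral[OF I] by blast+
  have fv_\<theta>: "i \<in> fv \<theta> \<Longrightarrow> i = 0 \<or> i = 1 \<or> i = 2" for i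
    using \<theta>(2) by blast
  let ?\<theta> = "rename ((!) [1, 2, 0]) \<theta>" and ?\<phi> = "rename (case_nat 0 (\<lambda>i. i + 3)) \<phi>"
  let ?D = "And (Equal (Var 1) (Var 1)) (Equal (Var 2) (Var 2))"
  let ?Suc3 = "Suc \<circ> Suc \<circ> Suc"
  define L where "L = Exists (And B (Exists (And A (subst_value \<theta> \<phi>))))"
  have wf_L: "wf_fm (lang_of T) L"
    using wf \<theta> \<phi> by (simp add: L_def wf_fm_subst_value)
  \<comment> \<open>Now the indices follow \<open>\<theta>\<close>: 0 is \<open>x0\<close>, 1 is
    \<open>x1\<close> and 2 is \<open>z\<close>.\<close>
  let ?\<Gamma> = "[rename (Suc \<circ> Suc) \<phi>, rename Suc B, A, \<theta>]"
  \<comment> \<open>The renamings accumulated while introducing the quantifiers of \<open>L\<close>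
    from the outside: \<open>x1\<close>, then \<open>x0\<close>, then \<open>z\<close>.\<close>
  let ?f1 = "case_nat 1 ?Suc3"
  let ?f2 = "case_nat 0 ?f1"
  let ?f3 = "case_nat 2 ?f2"
  have "derives T ?\<Gamma> (rename ?f3 ?D)"
    by (simp only: rename_simps subst_tm.simps) (intro derives_AndI derives.Refl; simp)
  moreover have "rename ?f3 (And ?\<theta> ?\<phi>) = And \<theta> (rename (Suc \<circ> Suc) \<phi>)"
  proof -
    have "rename (?f3 \<circ> (!) [1, 2, 0]) \<theta> = \<theta>"
      by (rule rename_id) (auto dest!: fv_\<theta> simp: eval_nat_numeral)
    moreover have "rename (?f3 \<circ> case_nat 0 (\<lambda>i. i + 3)) \<phi> = rename (Suc \<circ> Suc) \<phi>"
      by (rule rename_cong) (auto simp: eval_nat_numeral split: nat.split)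
    ultimately show ?thesis
      by (simp only: rename_simps(1,4) rename_rename)
  qed
  moreover have "derives T ?\<Gamma> (And \<theta> (rename (Suc \<circ> Suc) \<phi>))"
    by (intro derives_AndI derives.Assm) (use \<theta> \<phi> in simp_all)
  moreover have "derives T ?\<Gamma> (rename ?f2 A)"
    by (rule derives_rename_Assm[where g = id]) (auto simp: wf rename_id dest: fv)
  moreover have "derives T ?\<Gamma> (rename ?f1 B)"
    by (rule derives_rename_Assm[where g = Suc]) (auto simp: wf dest: fv)
  ultimately have "derives T ?\<Gamma> (rename ?Suc3 L)"
    unfolding L_def subst_value_def
    by (intro derives_rename_Exists_And[where k = 1 and f = ?Suc3]
        derives_rename_Exists_And[where k = 0 and f = ?f1]
        derives_rename_Exists_And[where k = 2 and f = ?f2])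
      (simp_all only:, use wf \<theta> \<phi> in simp_all)
  then have "T \<turnstile> Implies \<theta> (Implies A (Implies (rename Suc B)
      (Implies (rename (Suc \<circ> Suc) \<phi>) (rename ?Suc3 L))))"
    unfolding proves_def by (intro derives.ImpI) (use wf \<theta> \<phi> in simp_all)
  then have "T \<turnstile> Implies \<theta> (Implies A (rename Suc (Implies B (rename Suc
      (Implies \<phi> (rename Suc L))))))"
    by (simp only: rename_simps(4) rename_rename o_assoc)
  then have "T \<turnstile> Implies (Exists (And A \<theta>)) (Implies B (rename Suc (Implies \<phi> (rename Suc L))))"
    by (rule proves_Exists_And_Implies) (use wf wf_L \<theta> \<phi> in simp_all)
  then have elim: "T \<turnstile> Implies (Exists (And B (Exists (And A \<theta>)))) (Implies \<phi> (rename Suc L))"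
    by (rule proves_Exists_And_Implies) (use wf wf_L \<theta> \<phi> in simp_all)
  \<comment> \<open>Only \<open>z\<close> is left as a free index 0. Definability replaces the
    premise of \<open>elim\<close> by \<open>C\<close>, which gives the form needed to quantify
    \<open>z\<close> away.\<close>
  have "derives T [C, \<phi>] C" and "derives T [C, \<phi>] \<phi>"
    by (intro derives.Assm; use wf \<phi> in simp)+
  moreover have "T \<turnstile> Implies C (Exists (And B (Exists (And A \<theta>))))"
    using definable by (simp only: at_numerals.simps num_defs)
  ultimately have "derives T [C, \<phi>] (rename Suc L)"
    using elim proves_mp derives.ImpE by blast
  then have "T \<turnstile> Implies \<phi> (Implies C (rename Suc L))"
    unfolding proves_def by (intro derives.ImpI) (use wf \<phi> in simp_all)
  then have "T \<turnstile> Implies (Exists (And C \<phi>)) L"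
    by (rule proves_Exists_And_Implies) (use wf wf_L \<phi> in simp_all)
  then show ?thesis
    by (simp only: at_numerals.simps num_defs L_def)
qed

theorem theorem7p2:
  fixes T :: fo_theory and I :: translation and J :: "nat \<times> nat \<Rightarrow> nat" and n :: nat
  assumes "recursive_pairing J"
    and "wf_theory T" and "consistent T" and "re_theory T"
    and "n \<ge> 1"
    and "interprets I Num T"
    and "strongly_definable2 T I J"
    and "exact_Rosser T I n"
  shows "exact_Rosser T I (n + 1)"
proof -
  have I: "is_translation I (lang_of Num) (lang_of T)"
    using assms(6) by (simp add: interprets_def)
  have J: "bij J"
    using assms(1) by (simp add: recursive_pairing_def)
  obtain \<theta> where \<theta>: "wf_fm (lang_of T) \<theta>" "fv \<theta> \<subseteq> {0, 1, 2}"
    and definable: "\<And>a b. T \<turnstile> Forall (Iff (at_numerals I [a, b] \<theta>) (is_numeral I (J (a, b))))"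
    using assms(7) by (auto simp: strongly_definable2_def)
  have iff: "T \<turnstile> Iff (at_numerals I [a, b] \<theta>) (is_numeral I (J (a, b)))" (is "T \<turnstile> ?iff") for a b
  proof -
    have "fv ?iff \<subseteq> {0}"
    proof -
      have "i \<in> fv (is_numeral I c) \<Longrightarrow> i = 0" for c i
        using fv_is_numeral[OF I] by blast
      moreover have "i \<in> fv \<theta> \<Longrightarrow> i = 0 \<or> i = 1 \<or> i = 2" for i
        using \<theta>(2) by blast
      ultimately show ?thesis by fastforce
    qed
    \<comment> \<open>The outer quantifier is dropped by instantiating it with variable 0, the only
      one that can be free; this leaves the formula unchanged.\<close>
    then have "inst (Var 0) ?iff = ?iff"
      unfolding inst_eq_rename by (intro rename_id) (auto split: nat.split)
    moreover have "derives T [] (inst (Var 0) ?iff)"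
      using definable[of a b] unfolding proves_def by (rule derives.AllE) simp
    ultimately show ?thesis
      by (simp add: proves_def)
  qed
  note wf_num = wf_fm_is_numeral[OF I] and wf_at_num = wf_fm_at_numerals[OF I]
  have to: "T \<turnstile> Implies (at_numerals I [a, b] \<theta>) (is_numeral I (J (a, b)))"
    and from': "T \<turnstile> Implies (is_numeral I (J (a, b))) (at_numerals I [a, b] \<theta>)" for a b
    using iff[of a b] wf_num[of "J (a, b)"] wf_at_num[OF \<theta>(1), of "[a, b]"] unfolding proves_def
    by (blast intro: derives_AndD1 derives_AndD2 wf_fm.simps(4)[THEN iffD2])+
  show ?thesis
    unfolding exact_Rosser_def
  proof (intro allI impI)
    fix M1 M2
    assume M: "re_rel (n + 1) M1 \<and> re_rel (n + 1) M2 \<and> M1 \<inter> M2 = {}"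
    have "pair_up J M1 \<inter> pair_up J M2 = {}"
      using M J by (auto simp: pair_up_def dest: bij_is_inj injD)
    with M obtain \<phi> where \<phi>: "exactly_separates T I n \<phi> (pair_up J M1) (pair_up J M2)"
      using assms(1,5,8) re_rel_pair_up by (metis Suc_eq_plus1 exact_Rosser_def)
    then have wf: "wf_fm (lang_of T) \<phi>" and fv: "fv \<phi> = {..<n}"
      by (auto simp: exactly_separates_def)
    let ?\<psi> = "subst_value \<theta> \<phi>"
    have wf': "wf_fm (lang_of T) ?\<psi>"
      using wf \<theta> by (simp add: wf_fm_subst_value)
    have sep: "(as \<in> M1 \<longleftrightarrow> T \<turnstile> at_numerals I as ?\<psi>) \<and> (as \<in> M2 \<longleftrightarrow> T \<turnstile> Neg (at_numerals I as ?\<psi>))"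
      if len: "length as = n + 1" for as
    proof -
      obtain a b r where as: "as = a # b # r"
        using len \<open>n \<ge> 1\<close> by (cases as rule: list.exhaust; cases "tl as") auto
      \<comment> \<open>\<open>at_numerals\<close> places the first entries innermost, so the
        equivalence for \<open>a, b\<close> and \<open>J (a, b)\<close> extends to the entries
        \<open>r\<close> by monotonicity.\<close>
      have "T \<turnstile> Implies (at_numerals I r (at_numerals I [a, b] ?\<psi>))
          (at_numerals I r (at_numerals I [J (a, b)] \<phi>))"
        and "T \<turnstile> Implies (at_numerals I r (at_numerals I [J (a, b)] \<phi>))
          (at_numerals I r (at_numerals I [a, b] ?\<psi>))"
        using Implies_at_numerals_subst_value[OF I \<theta> wf to] at_numerals_subst_value_Implies[OF I \<theta> wf from']
          wf_at_num[OF wf] wf_at_num[OF wf'] by (blast intro: proves_at_numerals_mono[OF I])+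
      then have to': "T \<turnstile> Implies (at_numerals I as ?\<psi>) (at_numerals I (J (a, b) # r) \<phi>)"
        and from'': "T \<turnstile> Implies (at_numerals I (J (a, b) # r) \<phi>) (at_numerals I as ?\<psi>)"
        by (simp_all add: as)
      have "T \<turnstile> at_numerals I as ?\<psi> \<longleftrightarrow> T \<turnstile> at_numerals I (J (a, b) # r) \<phi>"
        using proves_mp[OF to'] proves_mp[OF from''] unfolding proves_def by blast
      \<comment> \<open>Contraposition transfers refutability, which settles the half of exactness
        that concerns \<open>M2\<close>.\<close>
      moreover have "T \<turnstile> Neg (at_numerals I as ?\<psi>) \<longleftrightarrow> T \<turnstile> Neg (at_numerals I (J (a, b) # r) \<phi>)"
        using proves_contrapos[OF to'] proves_contrapos[OF from''] wf_at_num[OF wf] wf_at_num[OF wf']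
        by blast
      moreover have "length (J (a, b) # r) = n"
        using len as by simp
      ultimately show ?thesis
        using \<phi> J unfolding exactly_separates_def as
        by (metis bij_is_inj pair_up_iff)
    qed
    then show "\<exists>\<psi>. exactly_separates T I (n + 1) \<psi> M1 M2"
      using wf' fv_subst_value[OF \<theta>(2) fv \<open>n \<ge> 1\<close>] unfolding exactly_separates_def by blast
  qed
qed

end
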